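(* Let $R,\tilde R\in\mathcal{R}_b^r$ and suppose that $R\succ\tilde R$, i.e. $R$ is more unequal than $\tilde R$ in Lorenz order. Then the associated game values satisfy $\mathcal{V}(R)\le\mathcal{V}(\tilde R)$.
   Context: Fix constants $T,\sigma,c>0$ and $x_0\in\mathbb{R}$. Let $\mathcal{R}_b^r$ be the set of bounded (weakly) increasing functions $R:[0,1]\to\mathbb{R}$ (bounded purely rank-based rewards). Lorenz order: for $R,\tilde R\in\mathcal{R}_b^r$, $R\succ\tilde R$ means $\int_0^1R(r)dr=\int_0^1\tilde R(r)dr$ and $\int_0^zR(r)dr\le\int_0^z\tilde R(r)dr$ for all $z\in[0,1]$. Game: let $\Omega=C([0,T],\mathbb{R})$ with canonical process $X$, and let $P$ be the law on $\Omega$ of $(x_0+\sigma B_t)_{t\in[0,T]}$, $B$ a standard Brownian motion started at $0$. Let $\mathcal{Q}=\{Q\in\mathcal{P}(\Omega):Q\sim P\}$ (mutually absolutely continuous), and write $Q_T$ for the law of $X_T$ under $Q$. With $H(Q|P)=E^Q[\ln(dQ/dP)]$ the relative entropy and $F_{\tilde\mu}$ the c.d.f. of $\tilde\mu\in\mathcal{P}(\mathbb{R})$, put $$V(R,\tilde\mu):=\sup_{Q\in\mathcal{Q}}\left\{E^Q\left[R(F_{\tilde\mu}(X_T))\right]-2c\sigma^2H(Q|P)\right\}.$$ A probability measure $\mu$ on $\mathbb{R}$ is an equilibrium for $R$ if $\mu=Q_T$ for some $Q\in\mathcal{Q}$ attaining the supremum $V(R,\mu)$. Each $R\in\mathcal{R}_b^r$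 has exactly one equilibrium, denoted $\mathcal{E}(R)$, and the game value is $\mathcal{V}(R):=V(R,\mathcal{E}(R))$. *)

theory Defs
  imports "HOL-Probability.Probability"
begin

text \<open>Paths are extensional functions (\<open>undefined\<close> off \<open>{0..T}\<close>), so that they correspond
  one-to-one to elements of \<open>C([0,T])\<close>. The sigma-algebra is generated by the coordinate maps,
  i.e. by the canonical process; it coincides with the Borel sigma-algebra of the sup norm.\<close>

definition path_space :: "real \<Rightarrow> (real \<Rightarrow> real) measure" where
  "path_space T = restrict_space (\<Pi>\<^sub>M t\<in>{0..T}. borel) {\<omega>. continuous_on {0..T} \<omega>}"

definition standard_brownian_motion ::
    "real \<Rightarrow> 'w measure \<Rightarrow> (real \<Rightarrow> 'w \<Rightarrow> real) \<Rightarrow> bool" where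
  "standard_brownian_motion T M B \<longleftrightarrow>
     prob_space M \<and>
     (\<forall>t\<in>{0..T}. B t \<in> borel_measurable M) \<and>
     (\<forall>\<omega>\<in>space M. B 0 \<omega> = 0 \<and> continuous_on {0..T} (\<lambda>t. B t \<omega>)) \<and>
     (\<forall>s t. 0 \<le> s \<and> s < t \<and> t \<le> T \<longrightarrow>
        distributed M lborel (\<lambda>\<omega>. B t \<omega> - B s \<omega>) (normal_density 0 (sqrt (t - s)))) \<and>
     (\<forall>(n::nat) \<tau>. strict_mono_on {..n} \<tau> \<and> \<tau> ` {..n} \<subseteq> {0..T} \<longrightarrow>
        prob_space.indep_vars M (\<lambda>_. borel)
          (\<lambda>i \<omega>. B (\<tau> (Suc i)) \<omega> - B (\<tau> i) \<omega>) {..<n})"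

definition state_law ::
    "real \<Rightarrow> real \<Rightarrow> real \<Rightarrow> 'w measure \<Rightarrow> (real \<Rightarrow> 'w \<Rightarrow> real) \<Rightarrow> (real \<Rightarrow> real) measure" where
  "state_law T \<sigma> x0 M B = distr M (path_space T) (\<lambda>\<omega>. \<lambda>t\<in>{0..T}. x0 + \<sigma> * B t \<omega>)"

lemma measurable_state_path:
  assumes "standard_brownian_motion T M B"
  shows "(\<lambda>\<omega>. \<lambda>t\<in>{0..T}. x0 + \<sigma> * B t \<omega>) \<in> measurable M (path_space T)"
proof -
  have meas: "B t \<in> borel_measurable M" if "t \<in> {0..T}" for t
    using assms that unfolding standard_brownian_motion_def by blast
  have cont: "continuous_on {0..T} (\<lambda>t. B t \<omega>)" if "\<omega> \<in> space M" for \<omega>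
    using assms that unfolding standard_brownian_motion_def by blast
  have "continuous_on {0..T} (\<lambda>t\<in>{0..T}. x0 + \<sigma> * B t \<omega>)" if "\<omega> \<in> space M" for \<omega>
  proof -
    have "continuous_on {0..T} (\<lambda>t. x0 + \<sigma> * B t \<omega>)"
      by (intro continuous_intros cont that)
    then show ?thesis
      by (rule continuous_on_eq) simp
  qed
  then show ?thesis
    unfolding path_space_def
    by (intro measurable_restrict_space2 measurable_restrict borel_measurable_add
          borel_measurable_times borel_measurable_const meas) auto
qed

definition equivalent_laws :: "real \<Rightarrow> (real \<Rightarrow> real) measure \<Rightarrow> (real \<Rightarrow> real) measure set" where
  "equivalent_laws T P =
     {Q. prob_space Q \<and> sets Q = sets (path_space T) \<and>
         absolutely_continuous P Q \<and> absolutely_continuous Q P}"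

text \<open>Since \<open>y ln y\<close> is bounded below, for \<open>Q\<close> absolutely continuous with respect to \<open>P\<close> the
  negative part of \<open>ln (dQ/dP)\<close> is always \<open>Q\<close>-integrable. The expectation hence exists in
  \<open>[0,\<infinity>]\<close>, and non-integrability means it is \<open>\<infinity>\<close>; the Bochner integral inside
  \<open>KL_divergence\<close> would return \<open>0\<close> there. In \<open>KL_divergence\<close> the reference measure is the
  first one, whereas here it is the second, as in the notation \<open>H(Q|P)\<close>.\<close>

definition relative_entropy :: "'a measure \<Rightarrow> 'a measure \<Rightarrow> ereal" where
  "relative_entropy Q P =
     (if integrable Q (entropy_density (exp 1) P Q) then ereal (KL_divergence (exp 1) P Q) else \<infinity>)"

lemma entropy_density_exp1: "entropy_density (exp 1) P Q = (\<lambda>\<omega>. ln (enn2real (RN_deriv P Q \<omega>)))"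
  by (simp add: entropy_density_def log_def fun_eq_iff)

text \<open>Only the values of a reward on \<open>{0..1}\<close> matter below.\<close>

definition bounded_rank_rewards :: "(real \<Rightarrow> real) set" where
  "bounded_rank_rewards = {R. mono_on {0..1} R \<and> bounded (R ` {0..1})}"

definition more_unequal :: "(real \<Rightarrow> real) \<Rightarrow> (real \<Rightarrow> real) \<Rightarrow> bool" where
  "more_unequal R R' \<longleftrightarrow>
     integral {0..1} R = integral {0..1} R' \<and>
     (\<forall>z\<in>{0..1}. integral {0..z} R \<le> integral {0..z} R')"

definition terminal_law :: "real \<Rightarrow> (real \<Rightarrow> real) measure \<Rightarrow> real measure" where
  "terminal_law T Q = distr Q borel (\<lambda>\<omega>. \<omega> T)"

definition payoff :: "real \<Rightarrow> real \<Rightarrow> real \<Rightarrow> (real \<Rightarrow> real) measure \<Rightarrow>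
    (real \<Rightarrow> real) \<Rightarrow> real measure \<Rightarrow> (real \<Rightarrow> real) measure \<Rightarrow> ereal" where
  "payoff T \<sigma> c P R \<mu> Q =
     ereal (\<integral>\<omega>. R (cdf \<mu> (\<omega> T)) \<partial>Q) - ereal (2 * c * \<sigma>\<^sup>2) * relative_entropy Q P"

definition best_value :: "real \<Rightarrow> real \<Rightarrow> real \<Rightarrow> (real \<Rightarrow> real) measure \<Rightarrow>
    (real \<Rightarrow> real) \<Rightarrow> real measure \<Rightarrow> ereal" where
  "best_value T \<sigma> c P R \<mu> = (SUP Q\<in>equivalent_laws T P. payoff T \<sigma> c P R \<mu> Q)"

definition is_equilibrium :: "real \<Rightarrow> real \<Rightarrow> real \<Rightarrow> (real \<Rightarrow> real) measure \<Rightarrow>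
    (real \<Rightarrow> real) \<Rightarrow> real measure \<Rightarrow> bool" where
  "is_equilibrium T \<sigma> c P R \<mu> \<longleftrightarrow>
     real_distribution \<mu> \<and>
     (\<exists>Q\<in>equivalent_laws T P.
        \<mu> = terminal_law T Q \<and> payoff T \<sigma> c P R \<mu> Q = best_value T \<sigma> c P R \<mu>)"

definition equilibrium :: "real \<Rightarrow> real \<Rightarrow> real \<Rightarrow> (real \<Rightarrow> real) measure \<Rightarrow>
    (real \<Rightarrow> real) \<Rightarrow> real measure" where
  "equilibrium T \<sigma> c P R = (THE \<mu>. is_equilibrium T \<sigma> c P R \<mu>)"

definition game_value :: "real \<Rightarrow> real \<Rightarrow> real \<Rightarrow> (real \<Rightarrow> real) measure \<Rightarrow>
    (real \<Rightarrow> real) \<Rightarrow> ereal" where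
  "game_value T \<sigma> c P R = best_value T \<sigma> c P R (equilibrium T \<sigma> c P R)"

end

theory Submission
  imports Defs
begin

text \<open>
  Put \<open>\<kappa> = 2 c \<sigma>\<^sup>2\<close>. The idea is that the game value has the closed form
  \<open>- \<kappa> ln (\<integral>\<^sub>0\<^sup>1 exp (- R r / \<kappa>) dr)\<close>, in which the Lorenz order acts through the convexity of the
  exponential.

  To obtain this form, fix a population law \<open>\<mu>\<close>. A player maximises \<open>E\<^sup>Q[f] - \<kappa> H(Q|P)\<close> for the
  bounded function \<open>f = R (F\<^sub>\<mu> (X\<^sub>T))\<close>. By the Gibbs variational principle
  (\<open>gibbs_variational_principle\<close>) the maximum is \<open>\<kappa> ln Z\<close> with \<open>Z = E\<^sup>P[exp (f / \<kappa>)]\<close>, attained only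
  by the law with density \<open>exp (f / \<kappa>) / Z\<close>. Since \<open>f\<close> depends on the endpoint alone, \<open>\<mu>\<close> is an
  equilibrium exactly when it is the tilt of the terminal reference law \<open>\<nu>\<close> by \<open>R (F\<^sub>\<mu>)\<close>, that is,
  when \<open>\<nu>\<close> has density \<open>Z exp (- R (F\<^sub>\<mu>) / \<kappa>)\<close> with respect to \<open>\<mu>\<close>.

  The law \<open>\<nu>\<close> has no atoms, hence neither has \<open>\<mu>\<close>, and \<open>F\<^sub>\<mu>\<close> is uniformly distributed under \<open>\<mu>\<close>
  (\<open>integral_rank_substitution\<close>). Therefore \<open>F\<^sub>\<nu> x = Z L (F\<^sub>\<mu> x)\<close>, where
  \<open>L z = \<integral>\<^sub>0\<^sup>z exp (- R r / \<kappa>) dr\<close>. Integrating over the whole line instead gives \<open>1 = Z L 1\<close>, hence the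
  value of \<open>Z\<close> (\<open>rank_tilt_fixed_point_cdf\<close>). Since \<open>L\<close> is continuous and strictly increasing,
  \<open>F\<^sub>\<mu>\<close> is determined and can be found by inversion (\<open>rank_tilt_fixed_point_unique\<close>,
  \<open>rank_tilt_fixed_point_exists\<close>). This proves \<open>game_value_eq\<close>. Finally, a more unequal increasing
  reward has the larger integral \<open>\<integral>\<^sub>0\<^sup>1 exp (- R r / \<kappa>) dr\<close> (\<open>lorenz_order_exp_integral\<close>).
\<close>

section \<open>The Gibbs variational principle\<close>

definition gibbs_normaliser :: "real \<Rightarrow> ('a \<Rightarrow> real) \<Rightarrow> 'a measure \<Rightarrow> real" where
  "gibbs_normaliser \<kappa> f M = (\<integral>x. exp (f x / \<kappa>) \<partial>M)"

text \<open>The candidate maximiser of \<open>E\<^sup>Q[f] - \<kappa> H(Q|M)\<close>; the maximum itself turns out to be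
\<open>\<kappa>\<close> times the logarithm of the normaliser.\<close>

definition gibbs_tilt :: "real \<Rightarrow> ('a \<Rightarrow> real) \<Rightarrow> 'a measure \<Rightarrow> 'a measure" where
  "gibbs_tilt \<kappa> f M = density M (\<lambda>x. ennreal (exp (f x / \<kappa>) / gibbs_normaliser \<kappa> f M))"

lemma (in finite_measure) integrable_exp_bounded:
  fixes f :: "'a \<Rightarrow> real"
  assumes [measurable]: "f \<in> borel_measurable M" and "\<And>x. \<bar>f x\<bar> \<le> C" and "0 < \<kappa>"
  shows "integrable M (\<lambda>x. exp (f x / \<kappa>))"
proof (rule integrable_const_bound)
  have "f x \<le> C" for x
    using assms(2)[of x] by linarith
  then show "AE x in M. norm (exp (f x / \<kappa>)) \<le> exp (C / \<kappa>)"
    using assms(3) by (simp add: divide_right_mono)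
qed measurable

lemma (in prob_space) gibbs_normaliser_pos:
  fixes f :: "'a \<Rightarrow> real"
  assumes [measurable]: "f \<in> borel_measurable M" and "\<And>x. \<bar>f x\<bar> \<le> C" and "0 < \<kappa>"
  shows "0 < gibbs_normaliser \<kappa> f M"
proof -
  note int = integrable_exp_bounded[OF assms]
  have "gibbs_normaliser \<kappa> f M \<noteq> 0"
    unfolding gibbs_normaliser_def
    using integral_nonneg_eq_0_iff_AE[OF int] by (simp add: AE_False)
  moreover have "0 \<le> gibbs_normaliser \<kappa> f M"
    unfolding gibbs_normaliser_def by simp
  ultimately show ?thesis
    by simp
qed

lemma (in prob_space) prob_space_gibbs_tilt:
  fixes f :: "'a \<Rightarrow> real"
  assumes [measurable]: "f \<in> borel_measurable M" and "\<And>x. \<bar>f x\<bar> \<le> C" and "0 < \<kappa>"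
  shows "prob_space (gibbs_tilt \<kappa> f M)"
proof (rule prob_spaceI)
  have pos: "0 < gibbs_normaliser \<kappa> f M"
    by (rule gibbs_normaliser_pos[OF assms])
  have int: "integrable M (\<lambda>x. exp (f x / \<kappa>) / gibbs_normaliser \<kappa> f M)"
    by (intro integrable_divide integrable_exp_bounded[OF assms])
  have "emeasure (gibbs_tilt \<kappa> f M) (space (gibbs_tilt \<kappa> f M)) =
      (\<integral>\<^sup>+x. ennreal (exp (f x / \<kappa>) / gibbs_normaliser \<kappa> f M) \<partial>M)"
    unfolding gibbs_tilt_def by (simp add: emeasure_density cong: nn_integral_cong)
  also have "\<dots> = ennreal (\<integral>x. exp (f x / \<kappa>) / gibbs_normaliser \<kappa> f M \<partial>M)"
    using pos by (intro nn_integral_eq_integral int) simp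
  also have "\<dots> = 1"
    using pos by (simp add: gibbs_normaliser_def)
  finally show "emeasure (gibbs_tilt \<kappa> f M) (space (gibbs_tilt \<kappa> f M)) = 1" .
qed

lemma (in prob_space) gibbs_tilt_equivalent:
  fixes f :: "'a \<Rightarrow> real"
  assumes [measurable]: "f \<in> borel_measurable M" and "\<And>x. \<bar>f x\<bar> \<le> C" and "0 < \<kappa>"
  shows "absolutely_continuous M (gibbs_tilt \<kappa> f M)"
    and "absolutely_continuous (gibbs_tilt \<kappa> f M) M"
proof -
  show "absolutely_continuous M (gibbs_tilt \<kappa> f M)"
    unfolding gibbs_tilt_def by (intro absolutely_continuousI_density) measurable
  have "0 < gibbs_normaliser \<kappa> f M"
    by (rule gibbs_normaliser_pos[OF assms])
  then have pos: "0 < exp (f x / \<kappa>) / gibbs_normaliser \<kappa> f M" for x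
    by simp
  show "absolutely_continuous (gibbs_tilt \<kappa> f M) M"
    unfolding absolutely_continuous_def
  proof
    fix A
    assume "A \<in> null_sets (gibbs_tilt \<kappa> f M)"
    then have A: "A \<in> sets M" and "AE x in M. x \<in> A \<longrightarrow> ennreal (exp (f x / \<kappa>) / gibbs_normaliser \<kappa> f M) = 0"
      unfolding gibbs_tilt_def by (simp_all add: null_sets_density_iff)
    have "AE x in M. x \<notin> A"
      using \<open>AE x in M. x \<in> A \<longrightarrow> _\<close>
    proof eventually_elim
      case (elim x)
      then show ?case
        using pos[of x] by (auto simp: ennreal_eq_0_iff)
    qed
    then show "A \<in> null_sets M"
      using A by (simp add: AE_iff_null_sets)
  qed
qed

text \<open>Under the tilted law the entropy density is \<open>f / \<kappa> - ln Z\<close>, with \<open>Z\<close> the normaliser. The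
expectation of \<open>f\<close> cancels and only \<open>\<kappa> ln Z\<close> is left.\<close>

lemma (in prob_space) gibbs_tilt_attains_maximum:
  fixes f :: "'a \<Rightarrow> real"
  assumes [measurable]: "f \<in> borel_measurable M" and bd: "\<And>x. \<bar>f x\<bar> \<le> C" and "0 < \<kappa>"
  defines "Q \<equiv> gibbs_tilt \<kappa> f M"
  shows "ereal (\<integral>x. f x \<partial>Q) - ereal \<kappa> * relative_entropy Q M
    = ereal (\<kappa> * ln (gibbs_normaliser \<kappa> f M))"
proof -
  define Z where "Z = gibbs_normaliser \<kappa> f M"
  have Z: "0 < Z"
    unfolding Z_def by (rule gibbs_normaliser_pos[OF assms(1-3)])
  interpret Q: prob_space Q
    unfolding Q_def by (rule prob_space_gibbs_tilt[OF assms(1-3)])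
  have sets_Q[measurable_cong]: "sets Q = sets M"
    by (simp add: Q_def gibbs_tilt_def)
  have intf: "integrable Q f"
    using bd by (intro Q.integrable_const_bound[of _ C]) auto
  have "AE x in M. ennreal (exp (f x / \<kappa>) / Z) = RN_deriv M Q x"
    by (intro RN_deriv_unique) (auto simp: Q_def gibbs_tilt_def Z_def)
  moreover have "absolutely_continuous M Q"
    unfolding Q_def by (rule gibbs_tilt_equivalent(1)[OF assms(1-3)])
  ultimately have "AE x in Q. ennreal (exp (f x / \<kappa>) / Z) = RN_deriv M Q x"
    using absolutely_continuous_AE[OF sets_Q] by blast
  then have eq: "AE x in Q. entropy_density (exp 1) M Q x = f x / \<kappa> - ln Z"
    unfolding entropy_density_exp1
  proof eventually_elim
    case (elim x)
    then have "enn2real (RN_deriv M Q x) = exp (f x / \<kappa>) / Z"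
      using Z by (metis divide_nonneg_pos enn2real_ennreal exp_ge_zero)
    then show ?case
      using Z by (simp add: ln_div)
  qed
  have "integrable Q (\<lambda>x. f x / \<kappa> - ln Z)"
    using intf by simp
  then have "integrable Q (entropy_density (exp 1) M Q)"
    using eq by (subst integrable_cong_AE[OF _ _ eq]) auto
  moreover have "KL_divergence (exp 1) M Q = (\<integral>x. f x / \<kappa> - ln Z \<partial>Q)"
    unfolding KL_divergence_def using eq by (intro integral_cong_AE) auto
  then have "KL_divergence (exp 1) M Q = (\<integral>x. f x \<partial>Q) / \<kappa> - ln Z"
    using intf by (simp add: Q.prob_space)
  ultimately show ?thesis
    using \<open>0 < \<kappa>\<close> by (simp add: relative_entropy_def Z_def field_simps)
qed

text \<open>The gap to the bound is \<open>\<kappa>\<close> times the relative entropy of \<open>Q\<close> with respect to the tilted law,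
which is nonnegative and vanishes only at the tilted law. If \<open>H(Q|M)\<close> is infinite the objective is
\<open>-\<infinity>\<close>. Otherwise, with densities \<open>D\<close> of \<open>Q\<close> and \<open>E\<close> of the tilted law, the integrand
\<open>ln (D / E)\<close> of this gap may be replaced by \<open>ln (D / E) - 1 + E / D\<close>, because \<open>E / D\<close> has
\<open>Q\<close>-expectation 1. The new integrand is pointwise nonnegative, and zero only where \<open>D = E\<close>; this
yields the inequality and the uniqueness together.\<close>

lemma (in prob_space) gibbs_variational_principle:
  fixes f :: "'a \<Rightarrow> real"
  assumes [measurable]: "f \<in> borel_measurable M" and bd: "\<And>x. \<bar>f x\<bar> \<le> C" and \<kappa>: "0 < \<kappa>"
    and Q: "prob_space Q" and sets_Q[measurable_cong]: "sets Q = sets M"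
    and ac: "absolutely_continuous M Q" "absolutely_continuous Q M"
  defines "v \<equiv> ereal (\<integral>x. f x \<partial>Q) - ereal \<kappa> * relative_entropy Q M"
  shows "v \<le> ereal (\<kappa> * ln (gibbs_normaliser \<kappa> f M))"
    and "v = ereal (\<kappa> * ln (gibbs_normaliser \<kappa> f M)) \<Longrightarrow> Q = gibbs_tilt \<kappa> f M"
proof -
  define Z where "Z = gibbs_normaliser \<kappa> f M"
  have Z: "0 < Z"
    unfolding Z_def by (rule gibbs_normaliser_pos[OF assms(1-3)])
  have main: "v \<le> ereal (\<kappa> * ln Z) \<and> (v = ereal (\<kappa> * ln Z) \<longrightarrow> Q = gibbs_tilt \<kappa> f M)"
  proof (cases "integrable Q (entropy_density (exp 1) M Q)")
    case False
    then have "v = -\<infinity>"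
      using \<kappa> by (simp add: v_def relative_entropy_def)
    then show ?thesis
      by simp
  next
    case True
    interpret Q: prob_space Q by fact
    obtain D where D[measurable]: "D \<in> borel_measurable M"
      and D_RN: "AE x in M. RN_deriv M Q x = ennreal (D x)"
      and D_pos: "AE x in Q. 0 < D x" and D_nonneg: "\<And>x. 0 \<le> D x"
      by (rule real_RN_deriv[OF Q.finite_measure_axioms ac(1) sets_Q]) (rule that)
    have "density M (RN_deriv M Q) = density M (\<lambda>x. ennreal (D x))"
      using D_RN by (intro density_cong) auto
    then have Q_eq: "Q = density M (\<lambda>x. ennreal (D x))"
      using density_RN_deriv[OF ac(1) sets_Q] by simp
    have D_pos_M: "AE x in M. 0 < D x"
      using absolutely_continuous_AE[OF sets_Q[symmetric] ac(2) D_pos] .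
    define E where "E = (\<lambda>x. exp (f x / \<kappa>) / Z)"
    have E[measurable]: "E \<in> borel_measurable M"
      unfolding E_def by measurable
    have E_pos: "0 < E x" for x
      using Z by (simp add: E_def)
    have E_int: "integrable M E" and E_one: "(\<integral>x. E x \<partial>M) = 1"
      using integrable_exp_bounded[OF assms(1-3)] Z
      by (simp_all add: E_def Z_def gibbs_normaliser_def)
    have intf: "integrable Q f"
      using bd by (intro Q.integrable_const_bound[of _ C]) auto
    have eq: "AE x in Q. entropy_density (exp 1) M Q x = ln (D x)"
      unfolding entropy_density_exp1
      using absolutely_continuous_AE[OF sets_Q ac(1) D_RN]
    proof eventually_elim
      case (elim x)
      then show ?case
        using D_nonneg[of x] by simp
    qed
    have int_ln: "integrable Q (\<lambda>x. ln (D x))"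
      using True by (subst integrable_cong_AE[OF _ _ eq, symmetric]) auto
    have KL: "KL_divergence (exp 1) M Q = (\<integral>x. ln (D x) \<partial>Q)"
      unfolding KL_divergence_def using eq by (intro integral_cong_AE) auto
    have DE: "AE x in M. D x * (E x / D x) = E x"
      using D_pos_M by eventually_elim simp
    have "integrable M (\<lambda>x. D x * (E x / D x))"
      using E_int by (subst integrable_cong_AE[OF _ _ DE]) auto
    then have int_ratio: "integrable Q (\<lambda>x. E x / D x)"
      unfolding Q_eq using D_nonneg by (subst integrable_real_density) auto
    have "(\<integral>x. E x / D x \<partial>Q) = (\<integral>x. D x * (E x / D x) \<partial>M)"
      unfolding Q_eq using D_nonneg by (subst integral_real_density) auto
    also have "\<dots> = 1"
      using DE E_one by (subst integral_cong_AE[OF _ _ DE]) auto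
    finally have ratio_one: "(\<integral>x. E x / D x \<partial>Q) = 1" .
    \<comment> \<open>The integrand \<open>ln (D / E) - 1 + E / D\<close>, written with \<open>ln E\<close> expanded so that every summand is integrable.\<close>
    define u where "u = (\<lambda>x. ln (D x) - (f x / \<kappa> - ln Z) - 1 + E x / D x)"
    have u_eq: "AE x in Q. u x = E x / D x - 1 - ln (E x / D x)"
      using D_pos
    proof eventually_elim
      case (elim x)
      have "ln (E x) = f x / \<kappa> - ln Z"
        using Z by (simp add: E_def ln_div)
      then show ?case
        using elim E_pos[of x] by (simp add: u_def ln_div)
    qed
    have u_nonneg: "AE x in Q. 0 \<le> u x"
      using u_eq D_pos
    proof eventually_elim
      case (elim x)
      then show ?case
        using ln_le_minus_one[of "E x / D x"] E_pos[of x] by simp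
    qed
    have u_int: "integrable Q u"
      unfolding u_def using int_ln intf int_ratio by simp
    have u_val: "(\<integral>x. u x \<partial>Q) = (\<integral>x. ln (D x) \<partial>Q) - (\<integral>x. f x \<partial>Q) / \<kappa> + ln Z"
      unfolding u_def using int_ln intf int_ratio ratio_one by (simp add: Q.prob_space)
    have v: "v = ereal (\<kappa> * ln Z - \<kappa> * (\<integral>x. u x \<partial>Q))"
      using True KL \<kappa> by (simp add: v_def relative_entropy_def u_val field_simps)
    have "0 \<le> (\<integral>x. u x \<partial>Q)"
      using u_nonneg by (rule integral_nonneg_AE)
    moreover have "Q = gibbs_tilt \<kappa> f M" if "(\<integral>x. u x \<partial>Q) = 0"
    proof -
      have "AE x in Q. u x = 0"
        using integral_nonneg_eq_0_iff_AE[OF u_int u_nonneg] that by simp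
      then have "AE x in Q. D x = E x"
        using u_eq D_pos
      proof eventually_elim
        case (elim x)
        then have "E x / D x = 1"
          using E_pos[of x] by (intro ln_eq_minus_one) auto
        then show ?case
          using elim by simp
      qed
      then have "AE x in M. D x = E x"
        by (rule absolutely_continuous_AE[OF sets_Q[symmetric] ac(2)])
      then have "density M (\<lambda>x. ennreal (D x)) = density M (\<lambda>x. ennreal (E x))"
        by (intro density_cong) auto
      then show ?thesis
        by (simp add: Q_eq[symmetric] gibbs_tilt_def E_def Z_def)
    qed
    ultimately show ?thesis
      using \<kappa> by (simp add: v)
  qed
  show "v \<le> ereal (\<kappa> * ln (gibbs_normaliser \<kappa> f M))"
    using main unfolding Z_def by blast
  show "Q = gibbs_tilt \<kappa> f M" if "v = ereal (\<kappa> * ln (gibbs_normaliser \<kappa> f M))"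
    using main that unfolding Z_def by blast
qed

text \<open>This makes the equilibrium equation symmetric: \<open>\<mu>\<close> is the tilt of \<open>\<nu>\<close> by \<open>f\<close> exactly when
\<open>\<nu>\<close> is the tilt of \<open>\<mu>\<close> by \<open>-f\<close>. The second form is the useful one when \<open>f\<close> is a
function of the ranks under \<open>\<mu>\<close>.\<close>

lemma (in prob_space) gibbs_tilt_inverse:
  fixes f :: "'a \<Rightarrow> real"
  assumes [measurable]: "f \<in> borel_measurable M" and bd: "\<And>x. \<bar>f x\<bar> \<le> C" and \<kappa>: "0 < \<kappa>"
  shows "gibbs_normaliser \<kappa> (\<lambda>x. - f x) (gibbs_tilt \<kappa> f M) = 1 / gibbs_normaliser \<kappa> f M"
    and "gibbs_tilt \<kappa> (\<lambda>x. - f x) (gibbs_tilt \<kappa> f M) = M"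
proof -
  define Z where "Z = gibbs_normaliser \<kappa> f M"
  have Z: "0 < Z"
    unfolding Z_def by (rule gibbs_normaliser_pos[OF assms])
  have "gibbs_normaliser \<kappa> (\<lambda>x. - f x) (gibbs_tilt \<kappa> f M)
      = (\<integral>x. exp (f x / \<kappa>) / Z * exp (- f x / \<kappa>) \<partial>M)"
    using Z unfolding gibbs_normaliser_def[of _ "\<lambda>x. - f x"] gibbs_tilt_def Z_def[symmetric]
    by (subst integral_real_density) auto
  also have "\<dots> = (\<integral>x. 1 / Z \<partial>M)"
    by (intro Bochner_Integration.integral_cong) (simp_all add: exp_minus field_simps)
  finally show norm: "gibbs_normaliser \<kappa> (\<lambda>x. - f x) (gibbs_tilt \<kappa> f M) = 1 / gibbs_normaliser \<kappa> f M"
    by (simp add: prob_space Z_def)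
  have "gibbs_tilt \<kappa> (\<lambda>x. - f x) (gibbs_tilt \<kappa> f M)
      = density (gibbs_tilt \<kappa> f M) (\<lambda>x. ennreal (exp (- f x / \<kappa>) * Z))"
    unfolding gibbs_tilt_def[of _ "\<lambda>x. - f x"] norm by (simp add: Z_def)
  also have "\<dots> = density M (\<lambda>x. ennreal (exp (f x / \<kappa>) / Z) * ennreal (exp (- f x / \<kappa>) * Z))"
    unfolding gibbs_tilt_def Z_def[symmetric] by (subst density_density_eq) auto
  also have "\<dots> = density M (\<lambda>x. 1)"
  proof (intro density_cong AE_I2)
    fix x
    have "exp (f x / \<kappa>) / Z * (exp (- f x / \<kappa>) * Z) = 1"
      using Z by (simp add: exp_minus field_simps)
    then show "ennreal (exp (f x / \<kappa>) / Z) * ennreal (exp (- f x / \<kappa>) * Z) = 1"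
      using Z by (simp add: ennreal_mult[symmetric])
  qed auto
  finally show "gibbs_tilt \<kappa> (\<lambda>x. - f x) (gibbs_tilt \<kappa> f M) = M"
    by (simp add: density_1)
qed

section \<open>Passing from states to ranks\<close>

lemma (in cdf_distribution) cdf_of_quantile:
  assumes cont_cdf: "\<And>x. isCont C x" and \<omega>: "0 < \<omega>" "\<omega> < 1"
  shows "C (I \<omega>) = \<omega>"
proof (rule antisym)
  have "(C \<longlongrightarrow> C (I \<omega>)) (at_left (I \<omega>))"
    using cont_cdf[of "I \<omega>"] unfolding isCont_def by (rule tendsto_within_subset) simp
  moreover have "\<forall>\<^sub>F y in at_left (I \<omega>). C y \<le> \<omega>"
    unfolding eventually_at_filter
  proof (intro always_eventually allI impI)
    fix y
    assume "y \<in> {..<I \<omega>}"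
    then have "\<not> I \<omega> \<le> y"
      by auto
    then show "C y \<le> \<omega>"
      unfolding pseudoinverse[OF \<omega>, symmetric] by linarith
  qed
  ultimately show "C (I \<omega>) \<le> \<omega>"
    by (intro tendsto_upperbound) auto
  show "\<omega> \<le> C (I \<omega>)"
    by (rule pseudoinverse[OF \<omega>, THEN iffD2]) (rule order_refl)
qed

text \<open>If \<open>Y\<close> has a continuous c.d.f. \<open>C\<close>, its rank \<open>C(Y)\<close> is uniform on \<open>[0,1]\<close>. The proof realises
\<open>Y\<close> as the quantile function \<open>I\<close> at a uniform point: there \<open>C (I \<omega>) = \<omega>\<close>, and \<open>I \<omega> \<le> x\<close>
means \<open>\<omega> \<le> C x\<close>, so flat pieces of \<open>C\<close> do no harm.\<close>

lemma (in cdf_distribution) integral_rank_substitution: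
  fixes h :: "real \<Rightarrow> real"
  assumes cont_cdf: "\<And>x. isCont C x"
    and [measurable]: "h \<in> borel_measurable borel" and bd: "\<And>r. \<bar>h r\<bar> \<le> b"
  shows "(\<integral>y. indicator {..x} y * h (C y) \<partial>M) = integral {0..C x} h"
    and "(\<integral>y. h (C y) \<partial>M) = integral {0..1} h"
proof -
  have push: "(\<integral>y. g y \<partial>M) = (\<integral>\<omega>. indicator {0<..<1} \<omega> * g (I \<omega>) \<partial>lborel)"
    if [measurable]: "g \<in> borel_measurable borel" for g :: "real \<Rightarrow> real"
  proof -
    have "(\<integral>y. g y \<partial>M) = (\<integral>y. g y \<partial>(distr (restrict_space lborel {0<..<1}) borel I))"
      by (simp add: distr_I_eq_M)
    also have "\<dots> = (\<integral>\<omega>. g (I \<omega>) \<partial>(restrict_space lborel {0<..<1}))"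
      by (intro integral_distr) (auto simp: measurable_CI)
    finally show ?thesis
      by (simp add: integral_restrict_space)
  qed
  have seg: "(\<integral>\<omega>. indicator {0..z} \<omega> * h \<omega> \<partial>lborel) = integral {0..z} h" if "0 \<le> z" for z
  proof -
    have "set_integrable lborel {0..z} h"
      unfolding set_integrable_def
      using bd that by (intro integrableI_bounded_set_indicator[where B=b]) auto
    from set_borel_integral_eq_integral(2)[OF this] show ?thesis
      by (simp add: set_lebesgue_integral_def)
  qed
  have "(\<integral>y. indicator {..x} y * h (C y) \<partial>M)
      = (\<integral>\<omega>. indicator {0<..<1} \<omega> * (indicator {..x} (I \<omega>) * h (C (I \<omega>))) \<partial>lborel)"
    by (rule push) measurable
  also have "\<dots> = (\<integral>\<omega>. indicator {0<..<1} \<omega> * (indicator {0..C x} \<omega> * h \<omega>) \<partial>lborel)"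
  proof (intro Bochner_Integration.integral_cong refl)
    fix \<omega> :: real
    show "indicator {0<..<1} \<omega> * (indicator {..x} (I \<omega>) * h (C (I \<omega>)))
        = indicator {0<..<1} \<omega> * (indicator {0..C x} \<omega> * h \<omega>)"
    proof (cases "0 < \<omega> \<and> \<omega> < 1")
      case True
      then show ?thesis
        using pseudoinverse[of \<omega> x] cdf_of_quantile[OF cont_cdf, of \<omega>] by (simp add: indicator_def)
    qed (simp add: indicator_def)
  qed
  also have "\<dots> = (\<integral>\<omega>. indicator {0..C x} \<omega> * h \<omega> \<partial>lborel)"
  proof (rule integral_cong_AE)
    show "AE \<omega> in lborel. indicator {0<..<1} \<omega> * (indicator {0..C x} \<omega> * h \<omega>) = indicator {0..C x} \<omega> * h \<omega>"
      using AE_lborel_singleton[of 0] AE_lborel_singleton[of 1]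
    proof eventually_elim
      case (elim \<omega>)
      then show ?case
        using cdf_bounded_prob[of x] by (auto simp: indicator_def)
    qed
  qed measurable
  finally show "(\<integral>y. indicator {..x} y * h (C y) \<partial>M) = integral {0..C x} h"
    by (simp add: seg cdf_nonneg)
  have "(\<integral>y. h (C y) \<partial>M) = (\<integral>\<omega>. indicator {0<..<1} \<omega> * h (C (I \<omega>)) \<partial>lborel)"
    by (rule push) measurable
  also have "\<dots> = (\<integral>\<omega>. indicator {0<..<1} \<omega> * h \<omega> \<partial>lborel)"
    by (intro Bochner_Integration.integral_cong refl) (simp add: indicator_def cdf_of_quantile[OF cont_cdf])
  also have "\<dots> = (\<integral>\<omega>. indicator {0..1} \<omega> * h \<omega> \<partial>lborel)"
  proof (rule integral_cong_AE)
    show "AE \<omega> in lborel. indicator {0<..<1} \<omega> * h \<omega> = indicator {0..1} \<omega> * h \<omega>"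
      using AE_lborel_singleton[of 0] AE_lborel_singleton[of 1]
    proof eventually_elim
      case (elim \<omega>)
      then show ?case
        by (auto simp: indicator_def)
    qed
  qed measurable
  finally show "(\<integral>y. h (C y) \<partial>M) = integral {0..1} h"
    by (simp add: seg)
qed

text \<open>Undoing the reward tilt at \<open>\<mu>\<close> gives each state a weight that depends on its rank alone, so in rank
coordinates the tilted law has density proportional to \<open>exp (- R r / \<kappa>)\<close>, whatever \<open>\<mu>\<close> is. This
is what makes the equilibrium explicit.\<close>

lemma cdf_gibbs_tilt_rank:
  fixes R :: "real \<Rightarrow> real"
  assumes "real_distribution \<mu>" and cont_cdf: "\<And>x. isCont (cdf \<mu>) x"
    and [measurable]: "R \<in> borel_measurable borel" and bd: "\<And>r. \<bar>R r\<bar> \<le> C" and \<kappa>: "0 < \<kappa>"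
  shows "gibbs_normaliser \<kappa> (\<lambda>x. - R (cdf \<mu> x)) \<mu> = integral {0..1} (\<lambda>r. exp (- R r / \<kappa>))"
    and "cdf (gibbs_tilt \<kappa> (\<lambda>x. - R (cdf \<mu> x)) \<mu>) x =
      integral {0..cdf \<mu> x} (\<lambda>r. exp (- R r / \<kappa>)) / integral {0..1} (\<lambda>r. exp (- R r / \<kappa>))"
proof -
  interpret cdf_distribution \<mu>
    using assms(1) by (simp add: cdf_distribution_def)
  define h where "h = (\<lambda>r. exp (- R r / \<kappa>))"
  have h[measurable]: "h \<in> borel_measurable borel"
    unfolding h_def by measurable
  have "- R r / \<kappa> \<le> C / \<kappa>" for r
    using bd[of r] \<kappa> by (intro divide_right_mono) auto
  then have h_bd: "\<bar>h r\<bar> \<le> exp (C / \<kappa>)" for r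
    by (simp add: h_def)
  define Z where "Z = integral {0..1} h"
  show norm: "gibbs_normaliser \<kappa> (\<lambda>x. - R (cdf \<mu> x)) \<mu> = integral {0..1} (\<lambda>r. exp (- R r / \<kappa>))"
    using integral_rank_substitution(2)[OF cont_cdf h h_bd]
    unfolding gibbs_normaliser_def h_def by simp
  then have Z_norm: "gibbs_normaliser \<kappa> (\<lambda>x. - R (cdf \<mu> x)) \<mu> = Z"
    by (simp add: Z_def h_def)
  have Z: "0 < Z"
    unfolding Z_norm[symmetric] using bd \<kappa> by (intro gibbs_normaliser_pos[where C=C]) auto
  define \<nu> where "\<nu> = gibbs_tilt \<kappa> (\<lambda>x. - R (cdf \<mu> x)) \<mu>"
  have "cdf \<nu> x = (\<integral>y. indicator {..x} y \<partial>\<nu>)"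
    by (simp add: cdf_def \<nu>_def gibbs_tilt_def)
  also have "\<dots> = (\<integral>y. h (cdf \<mu> y) / Z * indicator {..x} y \<partial>\<mu>)"
    using Z unfolding \<nu>_def gibbs_tilt_def Z_norm
    by (subst integral_real_density) (auto simp: h_def)
  also have "\<dots> = (\<integral>y. indicator {..x} y * h (cdf \<mu> y) \<partial>\<mu>) / Z"
    by (subst integral_divide_zero[symmetric]) (simp add: mult.commute)
  also have "\<dots> = integral {0..cdf \<mu> x} h / Z"
    by (subst integral_rank_substitution(1)[OF cont_cdf h h_bd]) simp
  finally show "cdf (gibbs_tilt \<kappa> (\<lambda>x. - R (cdf \<mu> x)) \<mu>) x =
      integral {0..cdf \<mu> x} (\<lambda>r. exp (- R r / \<kappa>)) / integral {0..1} (\<lambda>r. exp (- R r / \<kappa>))"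
    by (simp add: \<nu>_def h_def Z_def)
qed

section \<open>Existence and uniqueness of the fixed point\<close>

text \<open>The c.d.f. on \<open>[0,1]\<close> of the law with density proportional to \<open>exp (- R r / \<kappa>)\<close>. In
equilibrium it sends the rank of a state among the players to its rank under the reference law.\<close>

definition rank_share :: "real \<Rightarrow> (real \<Rightarrow> real) \<Rightarrow> real \<Rightarrow> real" where
  "rank_share \<kappa> R z =
    integral {0..z} (\<lambda>r. exp (- R r / \<kappa>)) / integral {0..1} (\<lambda>r. exp (- R r / \<kappa>))"

lemma
  fixes R :: "real \<Rightarrow> real"
  assumes R: "mono_on {0..1} R" and \<kappa>: "0 < \<kappa>"
  shows integral_exp_neg_reward_pos: "0 < integral {0..1} (\<lambda>r. exp (- R r / \<kappa>))"
    and strict_mono_rank_share: "strict_mono_on {0..1} (rank_share \<kappa> R)"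
    and continuous_rank_share: "continuous_on {0..1} (rank_share \<kappa> R)"
proof -
  define h where "h = (\<lambda>r. exp (- R r / \<kappa>))"
  have "mono_on {0..1} (\<lambda>r. - h r)"
    using R \<kappa> by (auto simp: mono_on_def divide_right_mono h_def)
  from integrable_neg[OF integrable_on_mono_on[OF this]] have int: "h integrable_on {0..1}"
    by simp
  have pos: "0 < integral {x..y} h" if "0 \<le> x" "x < y" "y \<le> 1" for x y
  proof -
    have "h integrable_on {x..y}"
      using that by (intro integrable_subinterval_real[OF int]) auto
    moreover have "exp (- R 1 / \<kappa>) \<le> h r" if "r \<in> {x..y}" for r
      using mono_onD[OF R, of r 1] \<kappa> that \<open>0 \<le> x\<close> \<open>y \<le> 1\<close>
      by (simp add: h_def divide_right_mono)
    ultimately have "integral {x..y} (\<lambda>_. exp (- R 1 / \<kappa>)) \<le> integral {x..y} h"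
      by (intro integral_le) auto
    moreover have "0 < integral {x..y} (\<lambda>_. exp (- R 1 / \<kappa>))"
      using that by simp
    ultimately show ?thesis
      by linarith
  qed
  then show Z: "0 < integral {0..1} (\<lambda>r. exp (- R r / \<kappa>))"
    by (simp add: h_def)
  show "strict_mono_on {0..1} (rank_share \<kappa> R)"
  proof (rule strict_mono_onI)
    fix x y :: real
    assume xy: "x \<in> {0..1}" "y \<in> {0..1}" "x < y"
    have "h integrable_on {0..y}"
      using xy by (intro integrable_subinterval_real[OF int]) auto
    then have "integral {0..x} h + integral {x..y} h = integral {0..y} h"
      using xy by (intro Henstock_Kurzweil_Integration.integral_combine) auto
    then have "integral {0..x} h < integral {0..y} h"
      using pos[of x y] xy by auto
    then show "rank_share \<kappa> R x < rank_share \<kappa> R y"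
      using Z by (simp add: rank_share_def h_def divide_strict_right_mono)
  qed
  show "continuous_on {0..1} (rank_share \<kappa> R)"
    using indefinite_integral_continuous_1[OF int] Z
    unfolding rank_share_def h_def by (intro continuous_intros) auto
qed

text \<open>Since the c.d.f. of \<open>\<nu>\<close> must be \<open>K \<circ> cdf \<mu>\<close>, with \<open>K\<close> the rank share, the only candidate for
\<open>cdf \<mu>\<close> is \<open>F = K\<^sup>-\<^sup>1 \<circ> cdf \<nu>\<close>. As \<open>K\<close> is a homeomorphism of \<open>[0,1]\<close>, this \<open>F\<close> is the
c.d.f. of some law \<open>\<mu>\<close>. Tilting \<open>\<mu>\<close> back by \<open>-R\<close> of its ranks gives a law with c.d.f.
\<open>K \<circ> F = cdf \<nu>\<close>, hence \<open>\<nu>\<close> itself.\<close>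

lemma rank_tilt_fixed_point_exists:
  fixes R :: "real \<Rightarrow> real"
  assumes \<nu>: "real_distribution \<nu>" and cont_cdf: "\<And>x. isCont (cdf \<nu>) x"
    and R: "mono R" and bd: "\<And>r. \<bar>R r\<bar> \<le> C" and \<kappa>: "0 < \<kappa>"
  obtains \<mu> where "real_distribution \<mu>" and "\<mu> = gibbs_tilt \<kappa> (\<lambda>x. R (cdf \<mu> x)) \<nu>"
proof -
  interpret \<nu>: real_distribution \<nu> by fact
  have [measurable]: "R \<in> borel_measurable borel"
    using R by (rule borel_measurable_mono)
  have R01: "mono_on {0..1} R"
    using R by (simp add: mono_on_def monoD)
  define K where "K = rank_share \<kappa> R"
  note K_less = strict_mono_onD[OF strict_mono_rank_share[OF R01 \<kappa>], folded K_def]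
  have K_cont: "continuous_on {0..1} K"
    unfolding K_def by (rule continuous_rank_share[OF R01 \<kappa>])
  have K0: "K 0 = 0" and K1: "K 1 = 1"
    using integral_exp_neg_reward_pos[OF R01 \<kappa>] by (simp_all add: K_def rank_share_def)
  have K_mono: "K x \<le> K y" if "0 \<le> x" "x \<le> y" "y \<le> 1" for x y
    using K_less[of x y] that by (cases "x = y") simp_all
  have K_inj: "inj_on K {0..1}"
    unfolding K_def by (rule strict_mono_on_imp_inj_on[OF strict_mono_rank_share[OF R01 \<kappa>]])
  have K_img: "K ` {0..1} = {0..1}"
  proof
    show "K ` {0..1} \<subseteq> {0..1}"
    proof
      fix u
      assume "u \<in> K ` {0..1}"
      then obtain r where "0 \<le> r" "r \<le> 1" "u = K r"
        by auto
      then show "u \<in> {0..1}"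
        using K_mono[of 0 r] K_mono[of r 1] by (simp add: K0 K1)
    qed
    show "{0..1} \<subseteq> K ` {0..1}"
    proof
      fix u :: real
      assume "u \<in> {0..1}"
      then obtain r where "0 \<le> r" "r \<le> 1" "K r = u"
        using IVT'[of K 0 u 1] K_cont K0 K1 by auto
      then show "u \<in> K ` {0..1}"
        by auto
    qed
  qed
  define G where "G = the_inv_into {0..1} K"
  have G_cont: "continuous_on {0..1} G"
    using continuous_on_inv_into[OF K_cont compact_Icc K_inj] by (simp add: K_img G_def)
  have G_in: "G u \<in> {0..1}" if "u \<in> {0..1}" for u
    unfolding G_def by (rule the_inv_into_into[OF K_inj _ subset_refl]) (unfold K_img, rule that)
  have KG: "K (G u) = u" if "u \<in> {0..1}" for u
    unfolding G_def by (rule f_the_inv_into_f[OF K_inj]) (unfold K_img, rule that)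
  have G0: "G 0 = 0" and G1: "G 1 = 1"
    using the_inv_into_f_f[OF K_inj, of 0] the_inv_into_f_f[OF K_inj, of 1] by (simp_all add: G_def K0 K1)
  have G_mono: "G u \<le> G v" if "u \<in> {0..1}" "v \<in> {0..1}" "u \<le> v" for u v
  proof (rule ccontr)
    assume "\<not> G u \<le> G v"
    then have "K (G v) < K (G u)"
      using that by (intro K_less G_in) auto
    then show False
      using that(3) by (simp add: KG[OF that(1)] KG[OF that(2)])
  qed
  have cdf_in: "cdf \<nu> x \<in> {0..1}" for x
    by (simp add: \<nu>.cdf_nonneg \<nu>.cdf_bounded_prob)
  define F where "F = (\<lambda>x. G (cdf \<nu> x))"
  have F_mono: "F x \<le> F y" if "x \<le> y" for x y
    unfolding F_def using that by (intro G_mono cdf_in \<nu>.cdf_nondecreasing)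
  have "continuous_on UNIV (cdf \<nu>)"
    using cont_cdf by (simp add: continuous_at_imp_continuous_on)
  then have "continuous_on UNIV F"
    unfolding F_def by (intro continuous_on_compose2[OF G_cont]) (use cdf_in in auto)
  then have F_cont: "isCont F x" for x
    by (simp add: continuous_on_eq_continuous_at)
  then have F_right: "continuous (at_right x) F" for x
    by (simp add: continuous_at_imp_continuous_within)
  have F_bot: "(F \<longlongrightarrow> 0) at_bot"
    unfolding F_def
    using continuous_on_tendsto_compose[OF G_cont \<nu>.cdf_lim_at_bot] cdf_in by (simp add: G0)
  have F_top: "(F \<longlongrightarrow> 1) at_top"
    unfolding F_def
    using continuous_on_tendsto_compose[OF G_cont \<nu>.cdf_lim_at_top_prob] cdf_in by (simp add: G1)
  define \<mu> where "\<mu> = interval_measure F"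
  have \<mu>: "real_distribution \<mu>"
    unfolding \<mu>_def by (rule real_distribution_interval_measure[OF F_mono F_right F_bot F_top])
  interpret \<mu>: real_distribution \<mu> by fact
  have cdf_\<mu>: "cdf \<mu> = F"
    unfolding \<mu>_def by (rule cdf_interval_measure[OF F_mono F_right F_bot])
  have F_meas[measurable]: "F \<in> borel_measurable borel"
    using F_mono by (intro borel_measurable_mono) (simp add: mono_def)
  define f where "f = (\<lambda>x. - R (F x))"
  have f_meas: "f \<in> borel_measurable \<mu>"
    unfolding f_def by measurable
  have f_bd: "\<bar>f x\<bar> \<le> C" for x
    using bd by (simp add: f_def)
  have "cdf (gibbs_tilt \<kappa> f \<mu>) x = cdf \<nu> x" for x
    using cdf_gibbs_tilt_rank(2)[of \<mu> R C \<kappa> x] \<mu> F_cont bd \<kappa> KG[OF cdf_in]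
    by (simp add: cdf_\<mu> f_def K_def rank_share_def F_def)
  moreover have "real_distribution (gibbs_tilt \<kappa> f \<mu>)"
    using \<mu>.prob_space_gibbs_tilt[OF f_meas f_bd \<kappa>]
    by (simp add: real_distribution_def real_distribution_axioms_def gibbs_tilt_def)
  ultimately have "gibbs_tilt \<kappa> f \<mu> = \<nu>"
    using \<nu> by (intro cdf_unique) auto
  then have "\<mu> = gibbs_tilt \<kappa> (\<lambda>x. R (cdf \<mu> x)) \<nu>"
    using \<mu>.gibbs_tilt_inverse(2)[OF f_meas f_bd \<kappa>] by (simp add: f_def cdf_\<mu>)
  with \<mu> show ?thesis
    by (rule that)
qed

text \<open>A fixed point is absolutely continuous with respect to \<open>\<nu>\<close>, so it has no atoms and its ranks are
uniform; inverting the tilt then expresses \<open>\<nu>\<close> through these ranks. The normaliser no longer depends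
on \<open>\<nu>\<close>, and this is why the game value depends only on \<open>R\<close> and \<open>\<kappa>\<close>.\<close>

lemma rank_tilt_fixed_point_cdf:
  fixes R :: "real \<Rightarrow> real"
  assumes \<nu>: "real_distribution \<nu>" and cont_cdf: "\<And>x. isCont (cdf \<nu>) x"
    and R[measurable]: "R \<in> borel_measurable borel" and bd: "\<And>r. \<bar>R r\<bar> \<le> C" and \<kappa>: "0 < \<kappa>"
    and \<mu>: "real_distribution \<mu>" and fixed: "\<mu> = gibbs_tilt \<kappa> (\<lambda>x. R (cdf \<mu> x)) \<nu>"
  shows "cdf \<nu> x = rank_share \<kappa> R (cdf \<mu> x)"
    and "gibbs_normaliser \<kappa> (\<lambda>x. R (cdf \<mu> x)) \<nu> = 1 / integral {0..1} (\<lambda>r. exp (- R r / \<kappa>))"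
proof -
  interpret \<nu>: real_distribution \<nu> by fact
  interpret \<mu>: cdf_distribution \<mu>
    using \<mu> by (simp add: cdf_distribution_def)
  define f where "f = (\<lambda>x. R (cdf \<mu> x))"
  have f_meas: "f \<in> borel_measurable \<nu>"
    unfolding f_def by measurable
  have f_bd: "\<bar>f x\<bar> \<le> C" for x
    using bd by (simp add: f_def)
  have fixed': "gibbs_tilt \<kappa> f \<nu> = \<mu>"
    using fixed by (simp add: f_def)
  have "absolutely_continuous \<nu> \<mu>"
    using \<nu>.gibbs_tilt_equivalent(1)[OF f_meas f_bd \<kappa>] by (simp add: fixed')
  moreover have "emeasure \<nu> {y} = 0" for y
    using cont_cdf[of y] by (simp add: \<nu>.isCont_cdf \<nu>.emeasure_eq_measure)
  ultimately have "emeasure \<mu> {y} = 0" for y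
    using absolutely_continuousD[of \<nu> \<mu> "{y}"] by simp
  then have cont_\<mu>: "isCont (cdf \<mu>) y" for y
    by (simp add: \<mu>.isCont_cdf measure_def)
  note inverse = \<nu>.gibbs_tilt_inverse[OF f_meas f_bd \<kappa>, unfolded fixed']
  note rank = cdf_gibbs_tilt_rank[OF \<mu> cont_\<mu> R bd \<kappa>]
  show "cdf \<nu> x = rank_share \<kappa> R (cdf \<mu> x)"
    using rank(2)[of x] inverse(2) by (simp add: f_def rank_share_def)
  show "gibbs_normaliser \<kappa> (\<lambda>x. R (cdf \<mu> x)) \<nu> = 1 / integral {0..1} (\<lambda>r. exp (- R r / \<kappa>))"
    using rank(1) inverse(1) by (simp add: f_def field_simps)
qed

lemma rank_tilt_fixed_point_unique:
  fixes R :: "real \<Rightarrow> real"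
  assumes \<nu>: "real_distribution \<nu>" and cont_cdf: "\<And>x. isCont (cdf \<nu>) x"
    and R: "mono R" and bd: "\<And>r. \<bar>R r\<bar> \<le> C" and \<kappa>: "0 < \<kappa>"
    and \<mu>: "real_distribution \<mu>" "\<mu> = gibbs_tilt \<kappa> (\<lambda>x. R (cdf \<mu> x)) \<nu>"
    and \<mu>': "real_distribution \<mu>'" "\<mu>' = gibbs_tilt \<kappa> (\<lambda>x. R (cdf \<mu>' x)) \<nu>"
  shows "\<mu> = \<mu>'"
proof (rule cdf_unique)
  note eq = rank_tilt_fixed_point_cdf(1)[OF \<nu> cont_cdf borel_measurable_mono[OF R] bd \<kappa>]
  have in01: "cdf \<mu> x \<in> {0..1}" "cdf \<mu>' x \<in> {0..1}" for x
    using \<mu>(1) \<mu>'(1)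
    by (auto simp: real_distribution.cdf_bounded_prob finite_borel_measure.cdf_nonneg
        real_distribution.finite_borel_measure_M)
  have "inj_on (rank_share \<kappa> R) {0..1}"
    using R \<kappa> by (intro strict_mono_on_imp_inj_on strict_mono_rank_share) (auto simp: mono_on_def monoD)
  then show "cdf \<mu> = cdf \<mu>'"
    using eq[OF \<mu>] eq[OF \<mu>'] in01 by (metis inj_onD ext)
qed (use \<mu> \<mu>' in auto)

section \<open>The game value\<close>

text \<open>Extends a reward from \<open>[0,1]\<close> to a monotone bounded function on the line, since the values off
\<open>[0,1]\<close> are arbitrary and could spoil measurability.\<close>

definition clamped_reward :: "(real \<Rightarrow> real) \<Rightarrow> real \<Rightarrow> real" where
  "clamped_reward R r = R (max 0 (min 1 r))"

lemma clamped_reward_eq: "r \<in> {0..1} \<Longrightarrow> clamped_reward R r = R r"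
  by (simp add: clamped_reward_def)

lemma mono_clamped_reward:
  assumes "R \<in> bounded_rank_rewards"
  shows "mono (clamped_reward R)"
proof (rule monoI)
  fix x y :: real
  assume "x \<le> y"
  then show "clamped_reward R x \<le> clamped_reward R y"
    using assms unfolding clamped_reward_def bounded_rank_rewards_def
    by (intro mono_onD[of "{0..1}" R]) auto
qed

lemma clamped_reward_bounded:
  assumes "R \<in> bounded_rank_rewards"
  obtains C where "\<And>r. \<bar>clamped_reward R r\<bar> \<le> C"
proof -
  obtain C where "\<forall>y\<in>R ` {0..1}. norm y \<le> C"
    using assms unfolding bounded_rank_rewards_def bounded_iff by blast
  then have "\<bar>clamped_reward R r\<bar> \<le> C" for r
    unfolding clamped_reward_def by simp
  then show ?thesis
    by (rule that)
qed

lemma measurable_terminal_value: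
  assumes "0 \<le> T" and "sets P = sets (path_space T)"
  shows "(\<lambda>\<omega>. \<omega> T) \<in> borel_measurable P"
proof -
  have "(\<lambda>\<omega>. \<omega> T) \<in> borel_measurable (path_space T)"
    unfolding path_space_def
    by (intro measurable_restrict_space1 measurable_component_singleton) (simp add: assms(1))
  then show ?thesis
    by (simp add: measurable_cong_sets[OF assms(2) refl])
qed

lemma terminal_law_gibbs_tilt:
  assumes X[measurable]: "(\<lambda>\<omega>. \<omega> T) \<in> borel_measurable P" and [measurable]: "g \<in> borel_measurable borel"
  shows "gibbs_normaliser \<kappa> (\<lambda>\<omega>. g (\<omega> T)) P = gibbs_normaliser \<kappa> g (terminal_law T P)"
    and "terminal_law T (gibbs_tilt \<kappa> (\<lambda>\<omega>. g (\<omega> T)) P) = gibbs_tilt \<kappa> g (terminal_law T P)"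
proof -
  show norm: "gibbs_normaliser \<kappa> (\<lambda>\<omega>. g (\<omega> T)) P = gibbs_normaliser \<kappa> g (terminal_law T P)"
    unfolding gibbs_normaliser_def terminal_law_def by (subst integral_distr) auto
  show "terminal_law T (gibbs_tilt \<kappa> (\<lambda>\<omega>. g (\<omega> T)) P) = gibbs_tilt \<kappa> g (terminal_law T P)"
    unfolding gibbs_tilt_def norm unfolding terminal_law_def
    by (subst density_distr) (auto simp: terminal_law_def)
qed

text \<open>For a fixed population law \<open>\<mu>\<close> a player solves a Gibbs problem on path space. The reward
depends on the path through its endpoint only, so the tilt and its normaliser can be computed on the
terminal law.\<close>

lemma
  assumes T: "0 \<le> T" and \<kappa>: "0 < 2 * c * \<sigma>\<^sup>2"
    and P: "prob_space P" and sets_P: "sets P = sets (path_space T)"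
    and R: "R \<in> bounded_rank_rewards" and \<mu>: "real_distribution \<mu>"
  defines "g \<equiv> (\<lambda>x. clamped_reward R (cdf \<mu> x))"
  shows best_value_eq_log_normaliser:
      "best_value T \<sigma> c P R \<mu> =
        ereal (2 * c * \<sigma>\<^sup>2 * ln (gibbs_normaliser (2 * c * \<sigma>\<^sup>2) g (terminal_law T P)))"
    and is_equilibrium_iff_fixed_point:
      "is_equilibrium T \<sigma> c P R \<mu> \<longleftrightarrow> \<mu> = gibbs_tilt (2 * c * \<sigma>\<^sup>2) g (terminal_law T P)"
proof -
  interpret P: prob_space P by fact
  interpret \<mu>: cdf_distribution \<mu>
    using \<mu> by (simp add: cdf_distribution_def)
  define \<kappa> where "\<kappa> = 2 * c * \<sigma>\<^sup>2"
  note [simp] = \<kappa>_def[symmetric]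
  have \<kappa>_pos: "0 < \<kappa>"
    using \<kappa> by simp
  have X[measurable]: "(\<lambda>\<omega>. \<omega> T) \<in> borel_measurable P"
    by (rule measurable_terminal_value[OF T sets_P])
  have [measurable]: "clamped_reward R \<in> borel_measurable borel"
    by (intro borel_measurable_mono mono_clamped_reward R)
  have g[measurable]: "g \<in> borel_measurable borel"
    unfolding g_def by measurable
  define f where "f = (\<lambda>\<omega>. g (\<omega> T))"
  have f: "f \<in> borel_measurable P"
    unfolding f_def by measurable
  obtain C where C: "\<And>r. \<bar>clamped_reward R r\<bar> \<le> C"
    using clamped_reward_bounded[OF R] by blast
  have f_bd: "\<bar>f \<omega>\<bar> \<le> C" for \<omega>
    unfolding f_def g_def by (rule C)
  have payoff: "payoff T \<sigma> c P R \<mu> Q = ereal (\<integral>\<omega>. f \<omega> \<partial>Q) - ereal \<kappa> * relative_entropy Q P" for Q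
    by (simp add: payoff_def f_def g_def clamped_reward_eq \<mu>.cdf_nonneg \<mu>.cdf_bounded_prob)
  define v where "v = ereal (\<kappa> * ln (gibbs_normaliser \<kappa> f P))"
  have upper: "payoff T \<sigma> c P R \<mu> Q \<le> v"
    and unique: "payoff T \<sigma> c P R \<mu> Q = v \<Longrightarrow> Q = gibbs_tilt \<kappa> f P"
    if "Q \<in> equivalent_laws T P" for Q
    using P.gibbs_variational_principle[OF f f_bd \<kappa>_pos, of Q] that sets_P
    unfolding payoff v_def equivalent_laws_def by auto
  have tilt: "gibbs_tilt \<kappa> f P \<in> equivalent_laws T P"
    using P.prob_space_gibbs_tilt[OF f f_bd \<kappa>_pos] P.gibbs_tilt_equivalent[OF f f_bd \<kappa>_pos]
    by (simp add: equivalent_laws_def sets_P[symmetric]) (simp add: gibbs_tilt_def)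
  have attained: "payoff T \<sigma> c P R \<mu> (gibbs_tilt \<kappa> f P) = v"
    unfolding payoff v_def by (rule P.gibbs_tilt_attains_maximum[OF f f_bd \<kappa>_pos])
  have best: "best_value T \<sigma> c P R \<mu> = v"
    unfolding best_value_def
    by (rule antisym[OF SUP_least[OF upper] SUP_upper2[OF tilt]]) (simp_all add: attained)
  then show "best_value T \<sigma> c P R \<mu> =
      ereal (2 * c * \<sigma>\<^sup>2 * ln (gibbs_normaliser (2 * c * \<sigma>\<^sup>2) g (terminal_law T P)))"
    using terminal_law_gibbs_tilt(1)[OF X g] by (simp add: v_def f_def)
  have law: "terminal_law T (gibbs_tilt \<kappa> f P) = gibbs_tilt \<kappa> g (terminal_law T P)"
    unfolding f_def by (rule terminal_law_gibbs_tilt(2)[OF X g])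
  show "is_equilibrium T \<sigma> c P R \<mu> \<longleftrightarrow> \<mu> = gibbs_tilt (2 * c * \<sigma>\<^sup>2) g (terminal_law T P)"
  proof
    assume "is_equilibrium T \<sigma> c P R \<mu>"
    then obtain Q where "Q \<in> equivalent_laws T P" "\<mu> = terminal_law T Q" "payoff T \<sigma> c P R \<mu> Q = v"
      unfolding is_equilibrium_def best by blast
    then show "\<mu> = gibbs_tilt (2 * c * \<sigma>\<^sup>2) g (terminal_law T P)"
      using unique[of Q] law by simp
  next
    assume "\<mu> = gibbs_tilt (2 * c * \<sigma>\<^sup>2) g (terminal_law T P)"
    then have "\<mu> = terminal_law T (gibbs_tilt \<kappa> f P)"
      by (simp add: law)
    then show "is_equilibrium T \<sigma> c P R \<mu>"
      unfolding is_equilibrium_def best using \<mu> tilt attained by blast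
  qed
qed

text \<open>At the equilibrium the normaliser is the reciprocal of \<open>\<integral>\<^sub>0\<^sup>1 exp (- R r / \<kappa>) dr\<close>, where
\<open>\<kappa> = 2 c \<sigma>\<^sup>2\<close>. Existence and uniqueness of the fixed point are what identifies the equilibrium
selected by the description operator.\<close>

lemma game_value_eq:
  assumes T: "0 \<le> T" and \<kappa>: "0 < 2 * c * \<sigma>\<^sup>2"
    and P: "prob_space P" and sets_P: "sets P = sets (path_space T)"
    and cont_cdf: "\<And>x. isCont (cdf (terminal_law T P)) x"
    and R: "R \<in> bounded_rank_rewards"
  shows "game_value T \<sigma> c P R =
    ereal (- (2 * c * \<sigma>\<^sup>2) * ln (integral {0..1} (\<lambda>r. exp (- R r / (2 * c * \<sigma>\<^sup>2)))))"
proof -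
  interpret P: prob_space P by fact
  define \<kappa> where "\<kappa> = 2 * c * \<sigma>\<^sup>2"
  have \<kappa>_pos: "0 < \<kappa>"
    using \<kappa> by (simp add: \<kappa>_def)
  define \<nu> where "\<nu> = terminal_law T P"
  have \<nu>: "real_distribution \<nu>"
    unfolding \<nu>_def terminal_law_def
    by (intro P.real_distribution_distr measurable_terminal_value[OF T sets_P])
  note cont_\<nu> = cont_cdf[folded \<nu>_def]
  let ?S = "clamped_reward R"
  have S: "mono ?S"
    by (rule mono_clamped_reward[OF R])
  obtain C where C: "\<And>r. \<bar>?S r\<bar> \<le> C"
    using clamped_reward_bounded[OF R] by blast
  have eq_iff: "is_equilibrium T \<sigma> c P R \<mu> \<longleftrightarrow>
      real_distribution \<mu> \<and> \<mu> = gibbs_tilt \<kappa> (\<lambda>x. ?S (cdf \<mu> x)) \<nu>" for \<mu>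
    using is_equilibrium_iff_fixed_point[OF T \<kappa> P sets_P R, of \<mu>]
    unfolding \<kappa>_def[symmetric] \<nu>_def[symmetric] by (auto simp: is_equilibrium_def)
  obtain \<mu> where \<mu>: "real_distribution \<mu>" "\<mu> = gibbs_tilt \<kappa> (\<lambda>x. ?S (cdf \<mu> x)) \<nu>"
    by (rule rank_tilt_fixed_point_exists[OF \<nu> cont_\<nu> S C \<kappa>_pos])
  have "equilibrium T \<sigma> c P R = \<mu>"
    unfolding equilibrium_def eq_iff
    by (rule the_equality) (use \<mu> rank_tilt_fixed_point_unique[OF \<nu> cont_\<nu> S C \<kappa>_pos] in blast)+
  then have "game_value T \<sigma> c P R = ereal (\<kappa> * ln (gibbs_normaliser \<kappa> (\<lambda>x. ?S (cdf \<mu> x)) \<nu>))"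
    unfolding game_value_def
    using best_value_eq_log_normaliser[OF T \<kappa> P sets_P R \<mu>(1)] by (simp add: \<kappa>_def \<nu>_def)
  also have "gibbs_normaliser \<kappa> (\<lambda>x. ?S (cdf \<mu> x)) \<nu>
      = 1 / integral {0..1} (\<lambda>r. exp (- ?S r / \<kappa>))"
    by (rule rank_tilt_fixed_point_cdf(2)[OF \<nu> cont_\<nu> borel_measurable_mono[OF S] C \<kappa>_pos \<mu>])
  also have "integral {0..1} (\<lambda>r. exp (- ?S r / \<kappa>)) = integral {0..1} (\<lambda>r. exp (- R r / \<kappa>))"
    by (intro Henstock_Kurzweil_Integration.integral_cong) (simp add: clamped_reward_eq)
  also have "\<kappa> * ln (1 / integral {0..1} (\<lambda>r. exp (- R r / \<kappa>)))
      = - \<kappa> * ln (integral {0..1} (\<lambda>r. exp (- R r / \<kappa>)))"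
    using integral_exp_neg_reward_pos[of R \<kappa>] R \<kappa>_pos
    by (simp add: bounded_rank_rewards_def ln_div)
  finally show ?thesis
    by (simp only: \<kappa>_def)
qed

text \<open>The increment \<open>B T - B 0\<close> has a density, so the terminal value, an affine image of it, hits no single
point with positive probability.\<close>

lemma terminal_law_state_law:
  assumes T: "0 < T" and \<sigma>: "0 < \<sigma>" and B: "standard_brownian_motion T M B"
  shows "prob_space (state_law T \<sigma> x0 M B)"
    and "isCont (cdf (terminal_law T (state_law T \<sigma> x0 M B))) x"
proof -
  interpret M: prob_space M
    using B by (simp add: standard_brownian_motion_def)
  note path = measurable_state_path[OF B, of x0 \<sigma>]
  show P: "prob_space (state_law T \<sigma> x0 M B)"
    unfolding state_law_def by (rule M.prob_space_distr[OF path])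
  have [measurable]: "B T \<in> borel_measurable M"
    using B T by (simp add: standard_brownian_motion_def)
  have "(\<lambda>\<omega>. \<omega> T) \<in> borel_measurable (path_space T)"
    using T by (intro measurable_terminal_value) auto
  then have law: "terminal_law T (state_law T \<sigma> x0 M B) = distr M borel (\<lambda>\<omega>. x0 + \<sigma> * B T \<omega>)"
    unfolding terminal_law_def state_law_def using T
    by (subst distr_distr[OF _ path]) (auto simp: comp_def)
  have "distributed M lborel (\<lambda>\<omega>. B T \<omega> - B 0 \<omega>) (normal_density 0 (sqrt (T - 0)))"
    using B T unfolding standard_brownian_motion_def by blast
  then have dens: "distr M lborel (\<lambda>\<omega>. B T \<omega> - B 0 \<omega>) = density lborel (normal_density 0 (sqrt T))"
    by (simp add: distributed_def)
  have B0: "B 0 \<omega> = 0" if "\<omega> \<in> space M" for \<omega>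
    using B that by (simp add: standard_brownian_motion_def)
  have "emeasure M {\<omega>\<in>space M. x0 + \<sigma> * B T \<omega> = x} = 0"
  proof -
    have "distr M lborel (\<lambda>\<omega>. B T \<omega> - B 0 \<omega>) = distr M lborel (B T)"
      by (intro distr_cong) (simp_all add: B0)
    then have "emeasure M (B T -` {(x - x0) / \<sigma>} \<inter> space M)
        = emeasure (density lborel (normal_density 0 (sqrt T))) {(x - x0) / \<sigma>}"
      using dens by (subst emeasure_distr[where N=lborel, symmetric]) auto
    also have "\<dots> = 0"
      by (simp add: emeasure_density nn_integral_0_iff_AE AE_lborel_singleton indicator_eq_0_iff
          AE_mp[OF AE_lborel_singleton[of "(x - x0) / \<sigma>"]])
    also have "B T -` {(x - x0) / \<sigma>} \<inter> space M = {\<omega>\<in>space M. x0 + \<sigma> * B T \<omega> = x}"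
      using \<sigma> by (auto simp: field_simps)
    finally show ?thesis .
  qed
  then have "measure (distr M borel (\<lambda>\<omega>. x0 + \<sigma> * B T \<omega>)) {x} = 0"
    by (simp add: measure_def emeasure_distr vimage_def Int_def conj_commute)
  moreover have "real_distribution (distr M borel (\<lambda>\<omega>. x0 + \<sigma> * B T \<omega>))"
    by (intro M.real_distribution_distr) measurable
  ultimately show "isCont (cdf (terminal_law T (state_law T \<sigma> x0 M B))) x"
    unfolding law
    using finite_borel_measure.isCont_cdf[OF real_distribution.finite_borel_measure_M] by blast
qed

section \<open>Lorenz order\<close>

text \<open>Writing \<open>\<phi> t = exp (- t / \<kappa>)\<close>, convexity gives \<open>\<phi> (R r) - \<phi> (R' r) \<ge> \<phi>' (R' r) (R r - R' r)\<close>.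
The factor \<open>\<phi>' (R' r)\<close> is increasing in \<open>r\<close>, so the second mean value theorem replaces it by its two
end values. Because \<open>R\<close> and \<open>R'\<close> have equal totals, the integral of the right-hand side becomes
\<open>(\<phi>' (R' 0) - \<phi>' (R' 1)) \<integral>\<^sub>0\<^sup>z (R - R') dr\<close> for some \<open>z\<close>, a product of two nonpositive numbers.\<close>

lemma lorenz_order_exp_integral:
  fixes R R' :: "real \<Rightarrow> real"
  assumes R: "mono_on {0..1} R" and R': "mono_on {0..1} R'" and "more_unequal R R'" and \<kappa>: "0 < \<kappa>"
  shows "integral {0..1} (\<lambda>r. exp (- R' r / \<kappa>)) \<le> integral {0..1} (\<lambda>r. exp (- R r / \<kappa>))"
proof -
  define d where "d = (\<lambda>r. R r - R' r)"
  define slope where "slope = (\<lambda>r. - exp (- R' r / \<kappa>) / \<kappa>)"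
  have int: "R integrable_on {0..1}" "R' integrable_on {0..1}"
    using R R' by (auto intro: integrable_on_mono_on)
  then have d: "d integrable_on {0..1}"
    unfolding d_def by (rule integrable_diff)
  have exp_int: "(\<lambda>r. exp (- S r / \<kappa>)) integrable_on {0..1}" if "mono_on {0..1} S" for S :: "real \<Rightarrow> real"
  proof -
    have "mono_on {0..1} (\<lambda>r. - exp (- S r / \<kappa>))"
      using that \<kappa> by (auto simp: mono_on_def divide_right_mono)
    from integrable_neg[OF integrable_on_mono_on[OF this]] show ?thesis
      by simp
  qed
  have slope_mono: "slope x \<le> slope y" if "0 \<le> x" "x \<le> y" "y \<le> 1" for x y
    using mono_onD[OF R', of x y] that \<kappa> by (simp add: slope_def divide_right_mono)
  obtain z where z: "z \<in> {0..1}"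
    and int_slope: "((\<lambda>r. slope r * d r) has_integral
      (slope 0 * integral {0..z} d + slope 1 * integral {z..1} d)) {0..1}"
    by (rule second_mean_value_theorem_full[OF d zero_le_one slope_mono])
  have sub: "f integrable_on {0..z}" if "f integrable_on {0..1}" for f :: "real \<Rightarrow> real"
    using z by (intro integrable_subinterval_real[OF that]) auto
  have dz: "integral {0..z} d = integral {0..z} R - integral {0..z} R'"
    unfolding d_def by (intro integral_diff sub int)
  have d1: "integral {0..1} d = integral {0..1} R - integral {0..1} R'"
    unfolding d_def by (intro integral_diff int)
  have "integral {0..z} d \<le> 0" and "integral {0..1} d = 0"
    using assms(3) z by (auto simp: dz d1 more_unequal_def)
  moreover have "integral {0..z} d + integral {z..1} d = integral {0..1} d"
    using z by (intro Henstock_Kurzweil_Integration.integral_combine[OF _ _ d]) auto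
  ultimately have "slope 0 * integral {0..z} d + slope 1 * integral {z..1} d
      = (slope 0 - slope 1) * integral {0..z} d"
    by (simp add: algebra_simps eq_neg_iff_add_eq_0[symmetric] add_eq_0_iff)
  also have "\<dots> \<ge> 0"
    using slope_mono[of 0 1] \<open>integral {0..z} d \<le> 0\<close> by (intro mult_nonpos_nonpos) auto
  finally have "0 \<le> integral {0..1} (\<lambda>r. slope r * d r)"
    using int_slope by (simp add: integral_unique)
  also have "\<dots> \<le> integral {0..1} (\<lambda>r. exp (- R r / \<kappa>) - exp (- R' r / \<kappa>))"
  proof (rule integral_le)
    show "(\<lambda>r. slope r * d r) integrable_on {0..1}"
      using int_slope by (rule has_integral_integrable)
    show "(\<lambda>r. exp (- R r / \<kappa>) - exp (- R' r / \<kappa>)) integrable_on {0..1}"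
      by (intro integrable_diff exp_int R R')
    fix r
    have "exp (- R' r / \<kappa>) * (1 + (- R r / \<kappa> - (- R' r / \<kappa>))) \<le>
        exp (- R' r / \<kappa>) * exp (- R r / \<kappa> - (- R' r / \<kappa>))"
      by (intro mult_left_mono exp_ge_add_one_self) simp
    also have "\<dots> = exp (- R r / \<kappa>)"
      by (simp add: exp_add[symmetric])
    finally show "slope r * d r \<le> exp (- R r / \<kappa>) - exp (- R' r / \<kappa>)"
      using \<kappa> by (simp add: slope_def d_def field_simps)
  qed
  also have "\<dots> = integral {0..1} (\<lambda>r. exp (- R r / \<kappa>)) - integral {0..1} (\<lambda>r. exp (- R' r / \<kappa>))"
    by (intro integral_diff exp_int R R')
  finally show ?thesis
    by simp
qed

theorem theorem4p1:
  fixes T \<sigma> c x0 :: real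
    and M :: "'w measure" and B :: "real \<Rightarrow> 'w \<Rightarrow> real"
    and P :: "(real \<Rightarrow> real) measure"
    and R R' :: "real \<Rightarrow> real"
  assumes "0 < T" and "0 < \<sigma>" and "0 < c"
    and "standard_brownian_motion T M B"
    and "P = state_law T \<sigma> x0 M B"
    and "R \<in> bounded_rank_rewards" and "R' \<in> bounded_rank_rewards"
    and "more_unequal R R'"
  shows "game_value T \<sigma> c P R \<le> game_value T \<sigma> c P R'"
proof -
  define \<kappa> where "\<kappa> = 2 * c * \<sigma>\<^sup>2"
  have \<kappa>: "0 < \<kappa>"
    using assms(2,3) by (simp add: \<kappa>_def)
  have P: "prob_space P" and sets_P: "sets P = sets (path_space T)"
    and cont: "isCont (cdf (terminal_law T P)) x" for x
    using terminal_law_state_law[OF assms(1,2,4)] by (simp_all add: assms(5)) (simp add: state_law_def)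
  have value_eq: "game_value T \<sigma> c P S = ereal (- \<kappa> * ln (integral {0..1} (\<lambda>r. exp (- S r / \<kappa>))))"
    if "S \<in> bounded_rank_rewards" for S
    using game_value_eq[of T c \<sigma> P S] assms(1) \<kappa> P sets_P cont that by (simp add: \<kappa>_def)
  have mono: "mono_on {0..1} R" "mono_on {0..1} R'"
    using assms(6,7) by (simp_all add: bounded_rank_rewards_def)
  have "ln (integral {0..1} (\<lambda>r. exp (- R' r / \<kappa>))) \<le> ln (integral {0..1} (\<lambda>r. exp (- R r / \<kappa>)))"
    using integral_exp_neg_reward_pos[OF mono(2) \<kappa>] lorenz_order_exp_integral[OF mono assms(8) \<kappa>]
    by (intro ln_mono) auto
  then show ?thesis
    using \<kappa> by (simp add: value_eq assms(6,7))
qed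

end
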